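(* Let $q$ be an odd prime and let $\chi_q:\mathbb{N}_0\to\mathbb{Q}$ be the numen of the Shortened $qx+1$ map. The limit $$\chi_q(\mathfrak{z})=\lim_{n\to\infty}\chi_q\left([\mathfrak{z}]_{2^n}\right)$$ exists in $\mathbb{Z}_q$ (in the $q$-adic topology) for all $\mathfrak{z}\in\mathbb{Z}_2$, and thereby defines an interpolation of $\chi_q$ to a function $\chi_q:\mathbb{Z}_2\to\mathbb{Z}_q$, with $\chi_q$ being continuous on $\mathbb{Z}_2^{\prime}$. Moreover: (I) For all $\mathfrak{z}\in\mathbb{Z}_2$: $\chi_q(2\mathfrak{z})=\frac{\chi_q(\mathfrak{z})}{2}$ and $\chi_q(2\mathfrak{z}+1)=\frac{q\chi_q(\mathfrak{z})+1}{2}$. (II) The interpolation $\chi_q:\mathbb{Z}_2\to\mathbb{Z}_q$ so defined is the unique function $f:\mathbb{Z}_2\to\mathbb{Z}_q$ satisfying the functional equations $f(2\mathfrak{z})=\frac{f(\mathfrak{z})}{2}$ and $f(2\mathfrak{z}+1)=\frac{qf(\mathfrak{z})+1}{2}$ for all $\mathfrak{z}\in\mathbb{Z}_2$, along with the rising-continuity condition $f(\mathfrak{z})=\lim_{n\to\infty}f([\mathfrak{z}]_{2^n})$ in $\mathbb{Z}_q$ for all $\mathfrak{z}\in\mathbb{Z}_2$.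
   Context: $\mathbb{N}_0=\{0,1,2,\ldots\}$ and $\mathbb{Z}_2^{\prime}=\mathbb{Z}_2\setminus\mathbb{N}_0$. For $\mathfrak{z}\in\mathbb{Z}_2$ and $n\geq 0$, $[\mathfrak{z}]_{2^n}$ is the unique integer in $\{0,\ldots,2^n-1\}$ congruent to $\mathfrak{z}$ mod $2^n$. The numen on $\mathbb{N}_0$: let $H_0(x)=x/2$ and $H_1(x)=(qx+1)/2$. For a finite string $\mathbf{j}=(j_1,\ldots,j_m)$ of $0$s and $1$s put $H_{\mathbf{j}}=H_{j_1}\circ\cdots\circ H_{j_m}$ (the identity for the empty string). For $n\in\mathbb{N}_0$ set $\chi_q(n)=H_{\mathbf{j}}(0)\in\mathbb{Q}$, where $\mathbf{j}$ is any string with $n=\sum_{k=1}^{m}j_k2^{k-1}$ (the value does not depend on the choice of $\mathbf{j}$). These rational numbers have power-of-$2$ denominators, so lie in $\mathbb{Z}_q$. *)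

theory Defs
  imports "HOL-Analysis.Analysis" "HOL-Algebra.Ring" "HOL-Number_Theory.Number_Theory"
begin

text \<open>
  The inverse limit of the rings of integers modulo \<open>p ^ n\<close>: the coordinate \<open>x n\<close> is the
  representative in \<open>{0..<p ^ n}\<close> of the residue class of \<open>x\<close> modulo \<open>p ^ n\<close>.
\<close>

definition padic_int :: "nat \<Rightarrow> (nat \<Rightarrow> int) ring" where
  "padic_int p =
    \<lparr>carrier = {x. \<forall>n. 0 \<le> x n \<and> x n < int p ^ n \<and> x (Suc n) mod int p ^ n = x n},
     mult = (\<lambda>x y n. (x n * y n) mod int p ^ n),
     one = (\<lambda>n. 1 mod int p ^ n),
     zero = (\<lambda>n. 0),
     add = (\<lambda>x y n. (x n + y n) mod int p ^ n)\<rparr>"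

definition padic_of_int :: "nat \<Rightarrow> int \<Rightarrow> nat \<Rightarrow> int" where
  "padic_of_int p k = (\<lambda>n. k mod int p ^ n)"

definition padic_divide :: "nat \<Rightarrow> (nat \<Rightarrow> int) \<Rightarrow> (nat \<Rightarrow> int) \<Rightarrow> nat \<Rightarrow> int" where
  "padic_divide p x y = x \<otimes>\<^bsub>padic_int p\<^esub> inv\<^bsub>padic_int p\<^esub> y"

text \<open>The embedding of the rationals; only meaningful if \<open>p\<close> does not divide the denominator.\<close>

definition padic_of_rat :: "nat \<Rightarrow> rat \<Rightarrow> nat \<Rightarrow> int" where
  "padic_of_rat p r =
    padic_divide p (padic_of_int p (fst (quotient_of r))) (padic_of_int p (snd (quotient_of r)))"

definition padic_naturals :: "nat \<Rightarrow> (nat \<Rightarrow> int) set" where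
  "padic_naturals p = range (\<lambda>n. padic_of_int p (int n))"

text \<open>The coordinate \<open>x n\<close> as a natural number, see \<open>padic_residue_unique\<close> below.\<close>

definition padic_residue :: "(nat \<Rightarrow> int) \<Rightarrow> nat \<Rightarrow> nat" where
  "padic_residue x n = nat (x n)"

text \<open>
  The distance \<open>\<bar>x - y\<bar>\<close>: the valuation of \<open>x - y\<close> is the greatest \<open>n\<close> such that \<open>x\<close> and \<open>y\<close>
  are congruent modulo \<open>p ^ n\<close>.
\<close>

definition padic_dist :: "nat \<Rightarrow> (nat \<Rightarrow> int) \<Rightarrow> (nat \<Rightarrow> int) \<Rightarrow> real" where
  "padic_dist p x y = (if x = y then 0 else 1 / real p ^ (GREATEST n. x n = y n))"

definition padic_topology :: "nat \<Rightarrow> (nat \<Rightarrow> int) topology" where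
  "padic_topology p = Metric_space.mtopology (carrier (padic_int p)) (padic_dist p)"

definition branch :: "nat \<Rightarrow> nat \<Rightarrow> rat \<Rightarrow> rat" where
  "branch q j x = (if j = 0 then x / 2 else (of_nat q * x + 1) / 2)"

definition branch_string :: "nat \<Rightarrow> nat list \<Rightarrow> rat \<Rightarrow> rat" where
  "branch_string q js = foldr (\<lambda>j h. branch q j \<circ> h) js id"

definition is_binary_expansion :: "nat list \<Rightarrow> nat \<Rightarrow> bool" where
  "is_binary_expansion js n \<longleftrightarrow>
    set js \<subseteq> {0, 1} \<and> n = (\<Sum>k<length js. js ! k * 2 ^ k)"

text \<open>The choice of the expansion is irrelevant, see \<open>numen_eq\<close> below.\<close>

definition numen :: "nat \<Rightarrow> nat \<Rightarrow> rat" where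
  "numen q n = branch_string q (SOME js. is_binary_expansion js n) 0"

definition numen_limit :: "nat \<Rightarrow> (nat \<Rightarrow> int) \<Rightarrow> nat \<Rightarrow> int" where
  "numen_limit q z =
    (THE x. limitin (padic_topology q)
       (\<lambda>n. padic_of_rat q (numen q (padic_residue z n))) x sequentially)"

definition numen_equations :: "nat \<Rightarrow> ((nat \<Rightarrow> int) \<Rightarrow> nat \<Rightarrow> int) \<Rightarrow> bool" where
  "numen_equations q f \<longleftrightarrow>
    (\<forall>z \<in> carrier (padic_int 2).
       f (padic_of_int 2 2 \<otimes>\<^bsub>padic_int 2\<^esub> z)
         = padic_divide q (f z) (padic_of_int q 2) \<and>
       f (padic_of_int 2 2 \<otimes>\<^bsub>padic_int 2\<^esub> z \<oplus>\<^bsub>padic_int 2\<^esub> \<one>\<^bsub>padic_int 2\<^esub>)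
         = padic_divide q
             (padic_of_int q (int q) \<otimes>\<^bsub>padic_int q\<^esub> f z \<oplus>\<^bsub>padic_int q\<^esub> \<one>\<^bsub>padic_int q\<^esub>)
             (padic_of_int q 2))"

definition rising_continuous :: "nat \<Rightarrow> ((nat \<Rightarrow> int) \<Rightarrow> nat \<Rightarrow> int) \<Rightarrow> bool" where
  "rising_continuous q f \<longleftrightarrow>
    (\<forall>z \<in> carrier (padic_int 2).
       limitin (padic_topology q)
         (\<lambda>n. f (padic_of_int 2 (int (padic_residue z n)))) (f z) sequentially)"

lemma padic_carrier_iff:
  "x \<in> carrier (padic_int p) \<longleftrightarrow>
    (\<forall>n. 0 \<le> x n \<and> x n < int p ^ n \<and> x (Suc n) mod int p ^ n = x n)"
  by (simp add: padic_int_def)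

lemma padic_mult_eq: "(x \<otimes>\<^bsub>padic_int p\<^esub> y) n = (x n * y n) mod int p ^ n"
  and padic_add_eq: "(x \<oplus>\<^bsub>padic_int p\<^esub> y) n = (x n + y n) mod int p ^ n"
  and padic_one_eq: "\<one>\<^bsub>padic_int p\<^esub> n = 1 mod int p ^ n"
  and padic_zero_eq: "\<zero>\<^bsub>padic_int p\<^esub> n = 0"
  by (simp_all add: padic_int_def)

lemma padic_coord_mod:
  assumes "x \<in> carrier (padic_int p)"
  shows "x n mod int p ^ n = x n"
  using assms by (auto simp: padic_carrier_iff)

lemma padic_coord_mod_le:
  assumes x: "x \<in> carrier (padic_int p)" and "m \<le> n"
  shows "x n mod int p ^ m = x m"
  using \<open>m \<le> n\<close>
proof (induction n rule: dec_induct)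
  case base
  show ?case using padic_coord_mod[OF x] .
next
  case (step n)
  have "x (Suc n) mod int p ^ m = (x (Suc n) mod int p ^ n) mod int p ^ m"
    by (rule mod_mod_cancel[symmetric]) (simp add: le_imp_power_dvd step.hyps)
  also have "\<dots> = x m"
    using x step.IH by (simp add: padic_carrier_iff)
  finally show ?case .
qed

lemma padic_carrierI:
  assumes "p > 0" and "\<And>n. [g (Suc n) = g n] (mod int p ^ n)"
  shows "(\<lambda>n. g n mod int p ^ n) \<in> carrier (padic_int p)"
  using assms by (auto simp: padic_carrier_iff cong_def mod_mod_cancel)

lemma padic_of_int_closed: "p > 0 \<Longrightarrow> padic_of_int p k \<in> carrier (padic_int p)"
  unfolding padic_of_int_def by (rule padic_carrierI) auto

lemma padic_cong_Suc:
  "x \<in> carrier (padic_int p) \<Longrightarrow> [x (Suc n) = x n] (mod int p ^ n)"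
  by (simp add: padic_carrier_iff cong_def)

lemma cring_padic_int:
  assumes p: "p > 0"
  shows "cring (padic_int p)"
proof (rule cringI)
  let ?R = "padic_int p"
  have zero: "\<zero>\<^bsub>?R\<^esub> = (\<lambda>n. 0)" by (simp add: padic_int_def)
  have add: "x \<oplus>\<^bsub>?R\<^esub> y = (\<lambda>n. (x n + y n) mod int p ^ n)" for x y
    by (simp add: padic_int_def)
  have mult: "x \<otimes>\<^bsub>?R\<^esub> y = (\<lambda>n. (x n * y n) mod int p ^ n)" for x y
    by (simp add: padic_int_def)
  have one: "\<one>\<^bsub>?R\<^esub> = (\<lambda>n. 1 mod int p ^ n)" by (simp add: padic_int_def)
  show "abelian_group ?R"
  proof (rule abelian_groupI)
    fix x y z
    assume x: "x \<in> carrier ?R" and y: "y \<in> carrier ?R" and z: "z \<in> carrier ?R"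
    show "x \<oplus>\<^bsub>?R\<^esub> y \<in> carrier ?R"
      unfolding add by (intro padic_carrierI p cong_add padic_cong_Suc x y)
    show "(x \<oplus>\<^bsub>?R\<^esub> y) \<oplus>\<^bsub>?R\<^esub> z = x \<oplus>\<^bsub>?R\<^esub> (y \<oplus>\<^bsub>?R\<^esub> z)"
      by (simp add: add mod_simps add.assoc)
    show "x \<oplus>\<^bsub>?R\<^esub> y = y \<oplus>\<^bsub>?R\<^esub> x"
      by (simp add: add add.commute)
  next
    fix x assume x: "x \<in> carrier ?R"
    show "\<zero>\<^bsub>?R\<^esub> \<oplus>\<^bsub>?R\<^esub> x = x"
      using padic_coord_mod[OF x] by (simp add: add zero)
    have "(\<lambda>n. (- x n) mod int p ^ n) \<in> carrier ?R"
      by (intro padic_carrierI p) (use padic_cong_Suc[OF x] in \<open>simp add: cong_minus_minus_iff\<close>)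
    moreover have "(\<lambda>n. (- x n) mod int p ^ n) \<oplus>\<^bsub>?R\<^esub> x = \<zero>\<^bsub>?R\<^esub>"
      by (simp add: add zero mod_simps)
    ultimately show "\<exists>y\<in>carrier ?R. y \<oplus>\<^bsub>?R\<^esub> x = \<zero>\<^bsub>?R\<^esub>" by blast
  next
    show "\<zero>\<^bsub>?R\<^esub> \<in> carrier ?R" using p by (simp add: padic_int_def)
  qed
  show "comm_monoid ?R"
  proof (rule comm_monoidI)
    fix x y z
    assume x: "x \<in> carrier ?R" and y: "y \<in> carrier ?R" and z: "z \<in> carrier ?R"
    show "x \<otimes>\<^bsub>?R\<^esub> y \<in> carrier ?R"
      unfolding mult by (intro padic_carrierI p cong_mult padic_cong_Suc x y)
    show "(x \<otimes>\<^bsub>?R\<^esub> y) \<otimes>\<^bsub>?R\<^esub> z = x \<otimes>\<^bsub>?R\<^esub> (y \<otimes>\<^bsub>?R\<^esub> z)"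
      by (simp add: mult mod_simps mult.assoc)
    show "x \<otimes>\<^bsub>?R\<^esub> y = y \<otimes>\<^bsub>?R\<^esub> x"
      by (simp add: mult mult.commute)
  next
    fix x assume x: "x \<in> carrier ?R"
    show "\<one>\<^bsub>?R\<^esub> \<otimes>\<^bsub>?R\<^esub> x = x"
      using padic_coord_mod[OF x] by (simp add: mult one mod_simps)
  next
    show "\<one>\<^bsub>?R\<^esub> \<in> carrier ?R"
      unfolding one by (rule padic_carrierI[OF p]) auto
  qed
  fix x y z
  show "(x \<oplus>\<^bsub>?R\<^esub> y) \<otimes>\<^bsub>?R\<^esub> z = x \<otimes>\<^bsub>?R\<^esub> z \<oplus>\<^bsub>?R\<^esub> y \<otimes>\<^bsub>?R\<^esub> z"
    by (simp add: mult add mod_simps distrib_right)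
qed

text \<open>Equality of coordinates is congruence modulo \<open>p ^ n\<close> in the ring.\<close>

lemma padic_coord_eq_iff:
  assumes p: "p > 0" and x: "x \<in> carrier (padic_int p)" and y: "y \<in> carrier (padic_int p)"
  shows "x n = y n \<longleftrightarrow>
    (\<exists>w \<in> carrier (padic_int p).
      x = y \<oplus>\<^bsub>padic_int p\<^esub> padic_of_int p (int p ^ n) \<otimes>\<^bsub>padic_int p\<^esub> w)"
proof
  assume "\<exists>w \<in> carrier (padic_int p).
      x = y \<oplus>\<^bsub>padic_int p\<^esub> padic_of_int p (int p ^ n) \<otimes>\<^bsub>padic_int p\<^esub> w"
  then obtain w where "x = y \<oplus>\<^bsub>padic_int p\<^esub> padic_of_int p (int p ^ n) \<otimes>\<^bsub>padic_int p\<^esub> w"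
    by blast
  then have "x n = (y n + (int p ^ n mod int p ^ n * w n) mod int p ^ n) mod int p ^ n"
    by (simp add: padic_add_eq padic_mult_eq padic_of_int_def)
  then show "x n = y n" using padic_coord_mod[OF y] by simp
next
  assume eq: "x n = y n"
  define g where "g k = (x (k + n) - y (k + n)) div int p ^ n" for k
  have dvd: "int p ^ n dvd x (k + n) - y (k + n)" for k
    using padic_coord_mod_le[OF x, of n "k + n"] padic_coord_mod_le[OF y, of n "k + n"] eq
    by (intro mod_eq_dvd_iff[THEN iffD1]) simp
  then have g: "int p ^ n * g k = x (k + n) - y (k + n)" for k
    by (simp add: g_def)
  have cong: "[g (Suc k) = g k] (mod int p ^ k)" for k
  proof -
    have "[x (Suc k + n) - y (Suc k + n) = x (k + n) - y (k + n)] (mod int p ^ (k + n))"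
      using padic_cong_Suc[OF x, of "k + n"] padic_cong_Suc[OF y, of "k + n"]
      by (simp add: cong_diff)
    then have "int p ^ n * int p ^ k dvd int p ^ n * (g (Suc k) - g k)"
      unfolding cong_iff_dvd_diff right_diff_distrib g by (simp add: power_add mult.commute)
    then show ?thesis
      using p by (simp add: cong_iff_dvd_diff)
  qed
  define w where "w = (\<lambda>k. g k mod int p ^ k)"
  have w: "w \<in> carrier (padic_int p)"
    unfolding w_def by (rule padic_carrierI[OF p cong])
  have "x k = (y \<oplus>\<^bsub>padic_int p\<^esub> padic_of_int p (int p ^ n) \<otimes>\<^bsub>padic_int p\<^esub> w) k" for k
  proof -
    have "(y \<oplus>\<^bsub>padic_int p\<^esub> padic_of_int p (int p ^ n) \<otimes>\<^bsub>padic_int p\<^esub> w) k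
        = (y k + int p ^ n * g k) mod int p ^ k"
      by (simp add: padic_add_eq padic_mult_eq padic_of_int_def w_def mod_simps)
    also have "\<dots> = (y (k + n) mod int p ^ k + (x (k + n) - y (k + n))) mod int p ^ k"
      using padic_coord_mod_le[OF y, of k "k + n"] by (simp add: g)
    also have "\<dots> = x k"
      using padic_coord_mod_le[OF x, of k "k + n"] by (simp add: mod_simps)
    finally show ?thesis by simp
  qed
  then show "\<exists>w \<in> carrier (padic_int p).
      x = y \<oplus>\<^bsub>padic_int p\<^esub> padic_of_int p (int p ^ n) \<otimes>\<^bsub>padic_int p\<^esub> w"
    using w by blast
qed

lemma padic_residue_unique:
  assumes p: "p > 0" and z: "z \<in> carrier (padic_int p)"
  shows "k = padic_residue z n \<longleftrightarrow>
    k < p ^ n \<and> (\<exists>w \<in> carrier (padic_int p).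
      z = padic_of_int p (int k) \<oplus>\<^bsub>padic_int p\<^esub>
            padic_of_int p (int p ^ n) \<otimes>\<^bsub>padic_int p\<^esub> w)"
proof -
  have z': "0 \<le> z n" "z n < int (p ^ n)" using z by (auto simp: padic_carrier_iff)
  have "z n = padic_of_int p (int k) n \<longleftrightarrow> z n = int k" if "k < p ^ n"
  proof -
    have "int k < int p ^ n" using that by (metis of_nat_less_iff of_nat_power)
    then show ?thesis by (simp add: padic_of_int_def)
  qed
  moreover have "k = nat (z n) \<longleftrightarrow> k < p ^ n \<and> z n = int k"
    using z' by (auto simp: nat_less_iff)
  ultimately show ?thesis
    unfolding padic_coord_eq_iff[OF p z padic_of_int_closed[OF p], symmetric] padic_residue_def
    by blast
qed

lemma padic_eqI:
  assumes x: "x \<in> carrier (padic_int p)" and y: "y \<in> carrier (padic_int p)"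
    and inf: "\<And>m. \<exists>n\<ge>m. x n = y n"
  shows "x = y"
proof
  fix m
  obtain n where "n \<ge> m" "x n = y n" using inf by blast
  then show "x m = y m"
    using padic_coord_mod_le[OF x] padic_coord_mod_le[OF y] by metis
qed

lemma padic_dist_le_iff:
  assumes p: "p > 1" and x: "x \<in> carrier (padic_int p)" and y: "y \<in> carrier (padic_int p)"
  shows "padic_dist p x y \<le> 1 / real p ^ n \<longleftrightarrow> x n = y n"
proof (cases "x = y")
  case True
  then show ?thesis by (simp add: padic_dist_def)
next
  case False
  then obtain m where m: "\<And>n. n \<ge> m \<Longrightarrow> x n \<noteq> y n"
    using padic_eqI[OF x y] by blast
  define v where "v = (GREATEST n. x n = y n)"
  have bd: "\<forall>n. x n = y n \<longrightarrow> n \<le> m" using m nat_le_linear by blast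
  have "x 0 = y 0" using x y
    by (metis mod_by_1 padic_coord_mod power_0)
  then have v: "x v = y v" unfolding v_def by (rule GreatestI_nat) (use bd in auto)
  have "n \<le> v \<longleftrightarrow> x n = y n"
  proof
    assume "n \<le> v"
    then show "x n = y n"
      using padic_coord_mod_le[OF x] padic_coord_mod_le[OF y] v by metis
  next
    assume "x n = y n"
    then show "n \<le> v" unfolding v_def by (rule Greatest_le_nat) (use bd in auto)
  qed
  moreover have "padic_dist p x y \<le> 1 / real p ^ n \<longleftrightarrow> n \<le> v"
    using p False by (simp add: padic_dist_def v_def field_simps)
  ultimately show ?thesis by simp
qed

lemma Metric_space_padic:
  assumes p: "p > 1"
  shows "Metric_space (carrier (padic_int p)) (padic_dist p)"
proof
  fix x y
  show "0 \<le> padic_dist p x y" by (simp add: padic_dist_def)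
  show "padic_dist p x y = padic_dist p y x" by (simp add: padic_dist_def eq_commute)
  show "padic_dist p x y = 0 \<longleftrightarrow> x = y"
    using p by (simp add: padic_dist_def)
next
  fix x y z
  assume x: "x \<in> carrier (padic_int p)" and y: "y \<in> carrier (padic_int p)"
    and z: "z \<in> carrier (padic_int p)"
  have nn: "0 \<le> padic_dist p x y" for x y by (simp add: padic_dist_def)
  show "padic_dist p x z \<le> padic_dist p x y + padic_dist p y z"
  proof (cases "x = y \<or> y = z")
    case True
    then show ?thesis by (auto simp: padic_dist_def)
  next
    case False
    then obtain a b where a: "padic_dist p x y = 1 / real p ^ a"
      and b: "padic_dist p y z = 1 / real p ^ b"
      by (simp add: padic_dist_def)
    have xy: "x a = y a" and yz: "y b = z b"
      using padic_dist_le_iff[OF p x y, of a] padic_dist_le_iff[OF p y z, of b] a b by auto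
    define c where "c = min a b"
    have "x c = y c" "y c = z c"
      using padic_coord_mod_le[OF x, of c] padic_coord_mod_le[OF y, of c]
        padic_coord_mod_le[OF z, of c] xy yz
      by (metis c_def min.cobounded1, metis c_def min.cobounded2)
    then have "padic_dist p x z \<le> 1 / real p ^ c"
      using padic_dist_le_iff[OF p x z] by simp
    also have "\<dots> = 1 / real p ^ a \<or> 1 / real p ^ c = 1 / real p ^ b"
      by (auto simp: c_def min_def)
    then have "1 / real p ^ c \<le> padic_dist p x y + padic_dist p y z"
      using nn[of x y] nn[of y z] a b by auto
    finally show ?thesis .
  qed
qed

lemma padic_of_int_unit:
  assumes p: "p > 0" and d: "coprime d (int p)"
  shows "padic_of_int p d \<in> Units (padic_int p)"
proof -
  have cop: "coprime d (int p ^ n)" for n using d by simp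
  then have "\<forall>n. \<exists>e. [d * e = 1] (mod int p ^ n)"
    using cong_solve_coprime_int by blast
  then obtain e where e: "\<And>n. [d * e n = 1] (mod int p ^ n)" by metis
  have "[e (Suc n) = e n] (mod int p ^ n)" for n
  proof -
    have "[d * e (Suc n) = 1] (mod int p ^ n)"
      using e[of "Suc n"] by (rule cong_dvd_modulus) simp
    then have "[d * e (Suc n) = d * e n] (mod int p ^ n)"
      using e[of n] cong_sym cong_trans by blast
    then show ?thesis using cop by (simp add: cong_mult_lcancel)
  qed
  then have ec: "(\<lambda>n. e n mod int p ^ n) \<in> carrier (padic_int p)"
    using padic_carrierI[OF p] by blast
  have "padic_of_int p d \<otimes>\<^bsub>padic_int p\<^esub> (\<lambda>n. e n mod int p ^ n) = \<one>\<^bsub>padic_int p\<^esub>"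
    using e by (auto simp: fun_eq_iff padic_mult_eq padic_one_eq padic_of_int_def mod_simps cong_def)
  moreover from this
  have "(\<lambda>n. e n mod int p ^ n) \<otimes>\<^bsub>padic_int p\<^esub> padic_of_int p d = \<one>\<^bsub>padic_int p\<^esub>"
    by (simp add: fun_eq_iff padic_mult_eq mult.commute)
  ultimately show ?thesis
    using ec padic_of_int_closed[OF p] unfolding Units_def by blast
qed

lemma padic_of_rat:
  assumes p: "p > 0" and r: "r = of_int a / of_int b" and b: "coprime b (int p)" "b \<noteq> 0"
  shows "padic_of_rat p r \<in> carrier (padic_int p)"
    and "padic_of_int p b \<otimes>\<^bsub>padic_int p\<^esub> padic_of_rat p r = padic_of_int p a"
proof -
  interpret R: cring "padic_int p" by (rule cring_padic_int[OF p])
  obtain c d where cd: "quotient_of r = (c, d)" by force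
  have d: "d > 0" "coprime c d" and rcd: "r = of_int c / of_int d"
    using cd quotient_of_denom_pos quotient_of_coprime quotient_of_div by blast+
  have "(of_int (c * b) :: rat) = of_int (a * d)"
    using r rcd b d by (simp add: field_simps)
  then have eq: "c * b = a * d" by (simp only: of_int_eq_iff)
  then have "d dvd c * b" by simp
  then have "d dvd b" using d coprime_dvd_mult_right_iff coprime_commute by blast
  then have "coprime d (int p)" using b(1) coprime_divisors[of d b "int p" "int p"] by simp
  then have u: "padic_of_int p d \<in> Units (padic_int p)" by (rule padic_of_int_unit[OF p])
  have cl: "padic_of_int p k \<in> carrier (padic_int p)" for k by (rule padic_of_int_closed[OF p])
  have mult: "padic_of_int p k \<otimes>\<^bsub>padic_int p\<^esub> padic_of_int p l = padic_of_int p (k * l)" for k l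
    by (simp add: fun_eq_iff padic_mult_eq padic_of_int_def mod_simps)
  have q: "padic_of_rat p r = padic_of_int p c \<otimes>\<^bsub>padic_int p\<^esub> inv\<^bsub>padic_int p\<^esub> padic_of_int p d"
    by (simp add: padic_of_rat_def padic_divide_def cd)
  show "padic_of_rat p r \<in> carrier (padic_int p)"
    using u cl by (simp add: q)
  have "padic_of_int p b \<otimes>\<^bsub>padic_int p\<^esub> padic_of_rat p r
      = padic_of_int p (c * b) \<otimes>\<^bsub>padic_int p\<^esub> inv\<^bsub>padic_int p\<^esub> padic_of_int p d"
    using u cl by (simp add: q R.m_assoc[symmetric] mult mult.commute)
  also have "\<dots> = padic_of_int p a"
    using u cl by (simp add: eq mult[symmetric] R.m_assoc)
  finally show "padic_of_int p b \<otimes>\<^bsub>padic_int p\<^esub> padic_of_rat p r = padic_of_int p a" .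
qed

lemma branch_string_simps [simp]:
  "branch_string q [] = id"
  "branch_string q (j # js) = branch q j \<circ> branch_string q js"
  by (simp_all add: branch_string_def)

lemma is_binary_expansion_Nil [simp]: "is_binary_expansion [] n \<longleftrightarrow> n = 0"
  by (auto simp: is_binary_expansion_def)

lemma is_binary_expansion_Cons:
  "is_binary_expansion (j # js) n \<longleftrightarrow> (\<exists>m. j \<in> {0, 1} \<and> is_binary_expansion js m \<and> n = j + 2 * m)"
  by (auto simp: is_binary_expansion_def sum.lessThan_Suc_shift sum_distrib_left mult_ac
      simp del: sum.lessThan_Suc)

lemma branch_string_unique:
  assumes "is_binary_expansion js n" "is_binary_expansion js' n"
  shows "branch_string q js 0 = branch_string q js' 0"
proof -
  have zero: "branch_string q js 0 = 0" if "is_binary_expansion js 0" for js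
    using that by (induction js) (auto simp: is_binary_expansion_Cons branch_def)
  show ?thesis using assms
  proof (induction js arbitrary: js' n)
    case Nil
    then show ?case using zero[of js'] by simp
  next
    case (Cons j js)
    show ?case
    proof (cases js')
      case Nil
      then show ?thesis using Cons.prems zero[of "j # js"] by simp
    next
      case (Cons j' js'')
      obtain m where m: "j \<in> {0, 1}" "is_binary_expansion js m" "n = j + 2 * m"
        using Cons.prems(1) by (auto simp: is_binary_expansion_Cons)
      obtain m' where m': "j' \<in> {0, 1}" "is_binary_expansion js'' m'" "n = j' + 2 * m'"
        using Cons.prems(2) Cons by (auto simp: is_binary_expansion_Cons)
      have "j = j'" "m = m'" using m m' by (auto, presburger+)
      then show ?thesis using Cons.IH[OF m(2)] m'(2) Cons by simp
    qed
  qed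
qed

lemma binary_expansion_exists: "\<exists>js. is_binary_expansion js n"
proof (induction n rule: less_induct)
  case (less n)
  show ?case
  proof (cases "n = 0")
    case False
    then obtain js where "is_binary_expansion js (n div 2)" using less[of "n div 2"] by auto
    then have "is_binary_expansion (n mod 2 # js) n"
      unfolding is_binary_expansion_Cons by (intro exI[of _ "n div 2"]) auto
    then show ?thesis by blast
  qed (auto intro: exI[of _ "[]"])
qed

lemma numen_eq: "is_binary_expansion js n \<Longrightarrow> numen q n = branch_string q js 0"
  unfolding numen_def
  by (rule branch_string_unique) (rule someI_ex[OF binary_expansion_exists])

lemma numen_denominator: "\<exists>a m. numen q n = of_int a / of_int (2 ^ m)"
proof -
  have "\<exists>a m. branch_string q js 0 = of_int a / of_int (2 ^ m)" for js
  proof (induction js)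
    case Nil
    show ?case by (auto intro: exI[of _ 0])
  next
    case (Cons j js)
    then obtain a m where am: "branch_string q js 0 = of_int a / of_int (2 ^ m)" by blast
    show ?case
    proof (cases "j = 0")
      case True
      then have "branch_string q (j # js) 0 = of_int a / of_int (2 ^ Suc m)"
        by (simp add: am branch_def)
      then show ?thesis by blast
    next
      case False
      then have "branch_string q (j # js) 0 = of_int (int q * a + 2 ^ m) / of_int (2 ^ Suc m)"
        by (simp add: am branch_def field_simps)
      then show ?thesis by blast
    qed
  qed
  then show ?thesis by (simp add: numen_def)
qed

lemma padic_of_rat_numen_closed:
  assumes "odd q"
  shows "padic_of_rat q (numen q n) \<in> carrier (padic_int q)"
proof -
  obtain a m where "numen q n = of_int a / of_int (2 ^ m)"
    using numen_denominator by blast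
  moreover have "coprime (2 ^ m) (int q)" "q > 0"
    using assms by (auto simp: coprime_left_2_iff_odd odd_pos)
  ultimately show ?thesis using padic_of_rat(1)[of q "numen q n" a "2 ^ m"] by simp
qed

end

theory Submission
  imports Defs
begin

text \<open>
  Every binary digit 1 of \<open>n\<close> multiplies the dependence of \<open>\<chi>\<^sub>q(n)\<close> on the higher digits by \<open>q\<close>, so
  \<open>\<chi>\<^sub>q(n)\<close> modulo \<open>q ^ k\<close> depends only on the digits up to the \<open>k\<close>-th 1.  A point of \<open>\<int>\<^sub>2 - \<nat>\<close> has
  infinitely many digits 1, which gives convergence and continuity there; on \<open>\<nat>\<close> the sequence of
  residues is eventually constant.
\<close>

section \<open>Convergence and continuity in the p-adic integers, read off coordinate by
  coordinate\<close>

lemma limitin_padic_iff: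
  assumes p: "p > 1" and f: "\<And>n. f n \<in> carrier (padic_int p)"
  shows "limitin (padic_topology p) f l sequentially \<longleftrightarrow>
    l \<in> carrier (padic_int p) \<and> (\<forall>k. \<forall>\<^sub>F n in sequentially. f n k = l k)"
proof -
  interpret Metric_space "carrier (padic_int p)" "padic_dist p"
    by (rule Metric_space_padic[OF p])
  \<comment> \<open>By \<open>padic_dist_le_iff\<close>, the closed ball of radius
    \<open>1 / p ^ k\<close> about \<open>l\<close> is the residue class of \<open>l\<close> modulo
    \<open>p ^ k\<close>. These radii tend to 0, so it suffices to test convergence on them.\<close>
  have "(\<forall>e>0. \<forall>\<^sub>F n in sequentially. padic_dist p (f n) l < e) \<longleftrightarrow>
      (\<forall>k. \<forall>\<^sub>F n in sequentially. f n k = l k)" if l: "l \<in> carrier (padic_int p)"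
  proof (intro iffI allI impI)
    fix k assume *: "\<forall>e>0. \<forall>\<^sub>F n in sequentially. padic_dist p (f n) l < e"
    have "1 / real p ^ k > 0" using p by simp
    then have "\<forall>\<^sub>F n in sequentially. padic_dist p (f n) l < 1 / real p ^ k" using * by blast
    then show "\<forall>\<^sub>F n in sequentially. f n k = l k"
      by eventually_elim (metis padic_dist_le_iff[OF p f l] less_imp_le)
  next
    fix e :: real
    assume *: "\<forall>k. \<forall>\<^sub>F n in sequentially. f n k = l k" and "e > 0"
    then obtain k where k: "(1 / real p) ^ k < e" using real_arch_pow_inv[of e "1 / real p"] p by auto
    have "\<forall>\<^sub>F n in sequentially. f n k = l k" using * by blast
    then show "\<forall>\<^sub>F n in sequentially. padic_dist p (f n) l < e"
    proof eventually_elim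
      case (elim n)
      then have "padic_dist p (f n) l \<le> (1 / real p) ^ k"
        using padic_dist_le_iff[OF p f l] by (simp add: power_one_over)
      then show ?case using k by simp
    qed
  qed
  then show ?thesis
    unfolding padic_topology_def limitin_metric using f by auto
qed

lemma topspace_padic: "p > 1 \<Longrightarrow> topspace (padic_topology p) = carrier (padic_int p)"
  unfolding padic_topology_def by (intro Metric_space.topspace_mtopology Metric_space_padic)

text \<open>Residue classes form a neighbourhood basis on both sides, so the epsilon-delta condition
  becomes: coordinate \<open>k\<close> of the value is decided by some coordinate \<open>n\<close>
  of the argument.\<close>

lemma topcontinuous_at_padicI:
  assumes p: "p > 1" and q: "q > 1"
    and f: "f \<in> carrier (padic_int p) \<rightarrow> carrier (padic_int q)"
    and x: "x \<in> carrier (padic_int p)"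
    and cont: "\<And>k. \<exists>n. \<forall>y \<in> carrier (padic_int p). y n = x n \<longrightarrow> f y k = f x k"
  shows "topcontinuous_at (padic_topology p) (padic_topology q) f x"
proof -
  interpret P: Metric_space "carrier (padic_int p)" "padic_dist p"
    by (rule Metric_space_padic[OF p])
  interpret Q: Metric_space "carrier (padic_int q)" "padic_dist q"
    by (rule Metric_space_padic[OF q])
  have "\<exists>U. openin P.mtopology U \<and> x \<in> U \<and> (\<forall>y\<in>U. f y \<in> V)"
    if V: "openin Q.mtopology V" and fx: "f x \<in> V" for V
  proof -
    obtain r where r: "r > 0" "Q.mball (f x) r \<subseteq> V"
      using V fx unfolding Q.openin_mtopology by blast
    obtain k where k: "(1 / real q) ^ k < r" using real_arch_pow_inv[of r "1 / real q"] r q by auto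
    obtain n where n: "\<And>y. y \<in> carrier (padic_int p) \<Longrightarrow> y n = x n \<Longrightarrow> f y k = f x k"
      using cont[of k] by blast
    \<comment> \<open>The open ball lies in the closed ball of the same radius, which is the class
      given by \<open>y n = x n\<close>; only this inclusion matters.\<close>
    define U where "U = P.mball x (1 / real p ^ n)"
    have "f y \<in> V" if "y \<in> U" for y
    proof -
      have y: "y \<in> carrier (padic_int p)" and "padic_dist p x y \<le> 1 / real p ^ n"
        using that by (auto simp: U_def)
      then have "y n = x n" using padic_dist_le_iff[OF p x y] by simp
      then have "f y k = f x k" using n y by blast
      moreover have fy: "f y \<in> carrier (padic_int q)" "f x \<in> carrier (padic_int q)"
        using f x y by auto
      ultimately have "padic_dist q (f x) (f y) \<le> (1 / real q) ^ k"
        using padic_dist_le_iff[OF q fy(2,1)] by (simp add: power_one_over)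
      then show ?thesis using k r fy by (intro subsetD[OF r(2)]) auto
    qed
    moreover have "x \<in> U" using x p by (simp add: U_def)
    ultimately show ?thesis unfolding U_def using P.openin_mball by blast
  qed
  then show ?thesis
    unfolding topcontinuous_at_def using f x topspace_padic[OF p] topspace_padic[OF q]
    unfolding padic_topology_def by (auto simp: Pi_iff)
qed

text \<open>Passes from continuity at a point of the whole space to continuity of the restriction,
  as needed for the complement of the naturals.\<close>

lemma topcontinuous_at_subtopology:
  assumes "topcontinuous_at X Y f x" and "x \<in> S"
  shows "topcontinuous_at (subtopology X S) Y f x"
proof -
  have "\<exists>U. openin (subtopology X S) U \<and> x \<in> U \<and> (\<forall>y\<in>U. f y \<in> V)"
    if V: "openin Y V" "f x \<in> V" for V
  proof -
    obtain U where "openin X U" "x \<in> U" "\<forall>y\<in>U. f y \<in> V"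
      using assms(1) V unfolding topcontinuous_at_def by blast
    then show ?thesis
      using assms by (intro exI[of _ "S \<inter> U"]) (auto intro: openin_subtopology_Int2)
  qed
  then show ?thesis using assms by (auto simp: topcontinuous_at_def)
qed

section \<open>Coordinates and division in the p-adic integers\<close>

lemma padic_coord_nonneg: "x \<in> carrier (padic_int p) \<Longrightarrow> 0 \<le> x n"
  by (simp add: padic_carrier_iff)

lemma padic_coord_zero: "x \<in> carrier (padic_int p) \<Longrightarrow> x 0 = 0"
  using padic_coord_mod[of x p 0] by simp

lemma padic_eq_iff_cong:
  assumes "x \<in> carrier (padic_int p)" and "y \<in> carrier (padic_int p)"
  shows "x k = y k \<longleftrightarrow> [x k = y k] (mod int p ^ k)"
  using padic_coord_mod[OF assms(1), of k] padic_coord_mod[OF assms(2), of k] by (simp add: cong_def)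

lemma padic_add_closed:
  "p > 0 \<Longrightarrow> x \<in> carrier (padic_int p) \<Longrightarrow> y \<in> carrier (padic_int p) \<Longrightarrow>
    x \<oplus>\<^bsub>padic_int p\<^esub> y \<in> carrier (padic_int p)"
  using cring_padic_int by (metis cring.cring_simprules(1))

lemma padic_mult_closed:
  "p > 0 \<Longrightarrow> x \<in> carrier (padic_int p) \<Longrightarrow> y \<in> carrier (padic_int p) \<Longrightarrow>
    x \<otimes>\<^bsub>padic_int p\<^esub> y \<in> carrier (padic_int p)"
  using cring_padic_int by (metis cring.cring_simprules(5))

lemma padic_one_closed: "p > 0 \<Longrightarrow> \<one>\<^bsub>padic_int p\<^esub> \<in> carrier (padic_int p)"
  using cring_padic_int by (metis cring.cring_simprules(6))

text \<open>An integer prime to \<open>p\<close> is a unit, so a quotient can be characterized by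
  multiplying back. This trades the ring inverse for congruences between integers.\<close>

lemma padic_divide_of_int_iff:
  assumes p: "p > 0" and d: "coprime d (int p)"
    and x: "x \<in> carrier (padic_int p)" and y: "y \<in> carrier (padic_int p)"
  shows "y = padic_divide p x (padic_of_int p d) \<longleftrightarrow> (\<forall>k. [d * y k = x k] (mod int p ^ k))"
proof -
  interpret R: cring "padic_int p" by (rule cring_padic_int[OF p])
  note u = padic_of_int_unit[OF p d]
  have "y = padic_divide p x (padic_of_int p d) \<longleftrightarrow> padic_of_int p d \<otimes>\<^bsub>padic_int p\<^esub> y = x"
    unfolding padic_divide_def
    using u x y R.m_assoc R.m_comm R.Units_closed R.Units_inv_closed R.Units_r_inv R.Units_l_inv
      R.l_one R.r_one
    by metis
  also have "\<dots> \<longleftrightarrow> (\<forall>k. [d * y k = x k] (mod int p ^ k))"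
    using padic_coord_mod[OF x]
    by (auto simp: fun_eq_iff padic_mult_eq padic_of_int_def cong_def mod_simps)
  finally show ?thesis .
qed

section \<open>Binary digits of 2-adic integers\<close>

lemma take_bit_padic_residue:
  assumes z: "z \<in> carrier (padic_int 2)" and "m \<le> n"
  shows "take_bit m (padic_residue z n) = padic_residue z m"
  using padic_coord_mod_le[OF z \<open>m \<le> n\<close>] nat_mod_distrib[OF padic_coord_nonneg[OF z], of "2 ^ m" n]
  by (simp add: padic_residue_def take_bit_eq_mod nat_power_eq)

lemma padic_residue_of_int:
  assumes "m < 2 ^ n"
  shows "padic_residue (padic_of_int 2 (int m)) n = m"
  using assms by (simp add: padic_residue_def padic_of_int_def nat_mod_distrib nat_power_eq)

text \<open>Doubling shifts the digits up by one place, hence the index \<open>Suc n\<close> on the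
  left against \<open>n\<close> on the right. Nothing is reduced on the right, since
  \<open>2 * z n + 1 < 2 ^ Suc n\<close>.\<close>

lemma padic_residue_double:
  assumes z: "z \<in> carrier (padic_int 2)"
  shows "padic_residue (padic_of_int 2 2 \<otimes>\<^bsub>padic_int 2\<^esub> z) (Suc n) = 2 * padic_residue z n"
    and "padic_residue (padic_of_int 2 2 \<otimes>\<^bsub>padic_int 2\<^esub> z \<oplus>\<^bsub>padic_int 2\<^esub> \<one>\<^bsub>padic_int 2\<^esub>) (Suc n)
      = 2 * padic_residue z n + 1"
proof -
  have z2: "z (Suc n) mod 2 ^ n = z n" "0 \<le> z n" "z n < 2 ^ n" using z by (auto simp: padic_carrier_iff)
  have eq: "(2 * z (Suc n)) mod 2 ^ Suc n = 2 * z n"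
    using z2 by (simp add: mult_mod_right)
  then show "padic_residue (padic_of_int 2 2 \<otimes>\<^bsub>padic_int 2\<^esub> z) (Suc n) = 2 * padic_residue z n"
    using z2 by (simp add: padic_residue_def padic_mult_eq padic_of_int_def mod_simps nat_mult_distrib
        del: power_Suc)
  have "(2 * z (Suc n) + 1) mod 2 ^ Suc n = (2 * z n + 1) mod 2 ^ Suc n"
    using eq by (metis mod_add_left_eq)
  also have "\<dots> = 2 * z n + 1" using z2 by simp
  finally show "padic_residue (padic_of_int 2 2 \<otimes>\<^bsub>padic_int 2\<^esub> z \<oplus>\<^bsub>padic_int 2\<^esub> \<one>\<^bsub>padic_int 2\<^esub>) (Suc n)
      = 2 * padic_residue z n + 1"
    using z2 by (simp add: padic_residue_def padic_mult_eq padic_add_eq padic_one_eq padic_of_int_def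
        mod_simps nat_mult_distrib nat_add_distrib del: power_Suc)
qed

text \<open>With only finitely many digits 1 the residues would become constant and \<open>z\<close>
  would be a natural number. The induction on \<open>k\<close> finds one further digit 1 at each
  stage.\<close>

lemma padic_non_natural_ones:
  fixes k :: nat
  assumes z: "z \<in> carrier (padic_int 2)" "z \<notin> padic_naturals 2"
  shows "\<exists>n. k \<le> (\<Sum>i<n. of_bool (bit (padic_residue z n) i))"
proof (induction k)
  case 0
  show ?case by simp
next
  case (Suc k)
  let ?r = "padic_residue z"
  obtain m where m: "k \<le> (\<Sum>i<m. of_bool (bit (?r m) i))" using Suc.IH by blast
  have "\<exists>n\<ge>m. ?r (Suc n) \<noteq> ?r n"
  proof (rule ccontr)
    assume "\<not> (\<exists>n\<ge>m. ?r (Suc n) \<noteq> ?r n)"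
    then have step: "?r (Suc n) = ?r n" if "n \<ge> m" for n using that by blast
    have r: "?r n = ?r m" if "n \<ge> m" for n
      using that by (induction n rule: dec_induct) (auto simp: step)
    have "z = padic_of_int 2 (int (?r m))"
    proof (rule padic_eqI[OF z(1) padic_of_int_closed])
      fix l
      have "z (l + m) = padic_of_int 2 (int (?r m)) (l + m)"
        using r[of "l + m"] z(1)
        by (metis le_add2 padic_coord_mod padic_of_int_def padic_residue_def int_nat_eq padic_carrier_iff)
      then show "\<exists>n\<ge>l. z n = padic_of_int 2 (int (?r m)) n" by (intro exI[of _ "l + m"]) simp
    qed simp
    then show False using z(2) by (auto simp: padic_naturals_def)
  qed
  then obtain n where n: "n \<ge> m" "?r (Suc n) \<noteq> ?r n" by blast
  \<comment> \<open>The two residues can differ only in the digit at place \<open>n\<close>, so that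
    digit is 1.\<close>
  have top: "bit (?r (Suc n)) n"
  proof (rule ccontr)
    assume "\<not> bit (?r (Suc n)) n"
    then have "take_bit (Suc n) (?r (Suc n)) = take_bit n (?r (Suc n))"
      by (simp add: take_bit_Suc_from_most)
    then show False
      using n(2) take_bit_padic_residue[OF z(1), of n "Suc n"]
        take_bit_padic_residue[OF z(1), of "Suc n" "Suc n"] by simp
  qed
  \<comment> \<open>The digits below \<open>m\<close> persist in the longer residue, so the
    \<open>k\<close> ones already counted remain, and place \<open>n\<close>, which is at least
    \<open>m\<close>, contributes a new one.\<close>
  have "bit (?r m) i = bit (?r (Suc n)) i" if "i < m" for i
    using that n(1) take_bit_padic_residue[OF z(1), of m "Suc n"] bit_take_bit_iff[of m "?r (Suc n)" i]
    by simp
  then have "k \<le> (\<Sum>i<m. of_bool (bit (?r (Suc n)) i))" using m by simp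
  also have "\<dots> \<le> (\<Sum>i<n. of_bool (bit (?r (Suc n)) i))"
    using n(1) by (intro sum_mono2) auto
  finally have "Suc k \<le> (\<Sum>i<Suc n. of_bool (bit (?r (Suc n)) i))" using top by simp
  then show ?case by blast
qed

section \<open>The recursion for the numen, over the rationals and modulo
  \<open>q ^ k\<close>\<close>

lemma numen_double: "numen q (2 * n) = numen q n / 2"
  and numen_double_plus_1: "numen q (2 * n + 1) = (of_nat q * numen q n + 1) / 2"
proof -
  obtain js where js: "is_binary_expansion js n" using binary_expansion_exists by blast
  have "is_binary_expansion (0 # js) (2 * n)" "is_binary_expansion (1 # js) (2 * n + 1)"
    using js by (auto simp: is_binary_expansion_Cons)
  then show "numen q (2 * n) = numen q n / 2" "numen q (2 * n + 1) = (of_nat q * numen q n + 1) / 2"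
    using js by (simp_all add: numen_eq branch_def)
qed

lemma padic_of_rat_cong:
  assumes "p > 0" "r = of_int a / of_int b" "coprime b (int p)" "b \<noteq> 0"
  shows "[b * padic_of_rat p r k = a] (mod int p ^ k)"
  using fun_cong[OF padic_of_rat(2)[OF assms], of k]
  by (simp add: padic_mult_eq padic_of_int_def cong_def mod_simps)

context
  fixes q :: nat
  assumes q: "odd q" "q > 1"
begin

private lemma q_simps: "q > 0" "coprime 2 (int q)" "coprime (2 ^ m) (int q)"
  using q by simp_all

private abbreviation (input) X :: "nat \<Rightarrow> nat \<Rightarrow> int" where
  "X n \<equiv> padic_of_rat q (numen q n)"

private lemmas chi_closed = padic_of_rat_numen_closed[OF q(1)]

text \<open>The functional equations on the naturals, with the division by 2 cleared. Both sides are
  compared after multiplication by the denominator \<open>2 ^ m\<close> of \<open>numen q n\<close>,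
  which is prime to \<open>q\<close> and can be cancelled again.\<close>

lemma numen_cong:
  shows "[2 * X (2 * n) k = X n k] (mod int q ^ k)"
    and "[2 * X (2 * n + 1) k = int q * X n k + 1] (mod int q ^ k)"
proof -
  obtain a m where am: "numen q n = of_int a / of_int (2 ^ m)" using numen_denominator by blast
  have cop: "coprime (2 ^ m) (int q ^ k)" using q_simps by simp
  have base: "[2 ^ m * X n k = a] (mod int q ^ k)"
    using padic_of_rat_cong[OF q_simps(1) am q_simps(3)] by simp
  have "numen q (2 * n) = of_int a / of_int (2 ^ Suc m)"
    using am by (simp add: numen_double)
  from padic_of_rat_cong[OF q_simps(1) this q_simps(3)]
  have "[2 ^ m * (2 * X (2 * n) k) = a] (mod int q ^ k)" by (simp add: mult_ac)
  then have "[2 ^ m * (2 * X (2 * n) k) = 2 ^ m * X n k] (mod int q ^ k)"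
    using base cong_sym cong_trans by blast
  then show "[2 * X (2 * n) k = X n k] (mod int q ^ k)"
    using cop by (simp add: cong_mult_lcancel)
  have "numen q (2 * n + 1) = of_int (int q * a + 2 ^ m) / of_int (2 ^ Suc m)"
    unfolding numen_double_plus_1 am by (simp add: field_simps)
  from padic_of_rat_cong[OF q_simps(1) this q_simps(3)]
  have "[2 ^ m * (2 * X (2 * n + 1) k) = int q * a + 2 ^ m] (mod int q ^ k)" by (simp add: mult_ac)
  moreover have "[2 ^ m * (int q * X n k + 1) = int q * a + 2 ^ m] (mod int q ^ k)"
    using cong_add[OF cong_scalar_left[OF base, of "int q"] cong_refl[of "2 ^ m"]]
    by (simp add: algebra_simps)
  ultimately have "[2 ^ m * (2 * X (2 * n + 1) k) = 2 ^ m * (int q * X n k + 1)] (mod int q ^ k)"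
    using cong_sym cong_trans by blast
  then show "[2 * X (2 * n + 1) k = int q * X n k + 1] (mod int q ^ k)"
    using cop by (simp add: cong_mult_lcancel)
qed

private lemma padic_coord_eqI:
  assumes "x \<in> carrier (padic_int q)" "y \<in> carrier (padic_int q)"
    and "[2 * x k = a] (mod int q ^ k)" "[2 * y k = b] (mod int q ^ k)" "[a = b] (mod int q ^ k)"
  shows "x k = y k"
proof -
  have "[2 * x k = 2 * y k] (mod int q ^ k)" using assms cong_sym cong_trans by meson
  then have "[x k = y k] (mod int q ^ k)" using q_simps by (simp add: cong_mult_lcancel)
  then show ?thesis using assms padic_eq_iff_cong by blast
qed

text \<open>Induction on the number of shared digits, removing the lowest one. A digit 0 halves the
  value and keeps the precision \<open>k\<close>; a digit 1 multiplies by \<open>q\<close>, so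
  precision \<open>k - 1\<close> for the remaining digits is enough. Each 1 among the shared digits
  thus buys one power of \<open>q\<close>.\<close>

lemma numen_coord_eq:
  assumes "take_bit n a = take_bit n b" and "k \<le> (\<Sum>i<n. of_bool (bit a i))"
  shows "X a k = X b k"
  using assms
proof (induction n arbitrary: a b k)
  case 0
  \<comment> \<open>The empty digit sum forces \<open>k = 0\<close>, and coordinate 0 is a residue
    modulo 1.\<close>
  then show ?case using padic_coord_zero[OF chi_closed] by simp
next
  case (Suc n)
  define a' b' where "a' = a div 2" and "b' = b div 2"
  have par: "a mod 2 = b mod 2" and tb: "take_bit n a' = take_bit n b'"
    using Suc.prems(1) unfolding take_bit_Suc a'_def b'_def by presburger+
  have k: "k \<le> of_bool (odd a) + (\<Sum>i<n. of_bool (bit a' i))"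
    using Suc.prems(2) by (simp add: sum.lessThan_Suc_shift bit_0 bit_Suc a'_def del: sum.lessThan_Suc)
  show ?case
  proof (cases "even a")
    case True
    then have ab: "a = 2 * a'" "b = 2 * b'" using par unfolding a'_def b'_def by presburger+
    have "X a' k = X b' k" using Suc.IH[OF tb] k True by simp
    then show ?thesis
      unfolding ab by (intro padic_coord_eqI[OF chi_closed chi_closed numen_cong(1) numen_cong(1)]) simp
  next
    case False
    then have ab: "a = 2 * a' + 1" "b = 2 * b' + 1" using par unfolding a'_def b'_def by presburger+
    show ?thesis
    proof (cases k)
      case 0
      then show ?thesis using padic_coord_zero[OF chi_closed] by simp
    next
      case (Suc l)
      have "X a' l = X b' l" using Suc.IH[OF tb] k False Suc by simp
      \<comment> \<open>Agreement is known in coordinate \<open>l\<close> only, which says that the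
        coordinates \<open>k\<close> are congruent modulo \<open>q ^ l\<close>. The factor
        \<open>q\<close> then lifts this to modulus \<open>q ^ Suc l\<close>, that is
        \<open>q ^ k\<close>.\<close>
      then have "[X a' k = X b' k] (mod int q ^ l)"
        using padic_coord_mod_le[OF chi_closed, of l k] Suc by (simp add: cong_def)
      then have "[int q * X a' k = int q * X b' k] (mod int q ^ k)"
        using Suc by (simp add: cong_iff_dvd_diff right_diff_distrib[symmetric])
      then have "[int q * X a' k + 1 = int q * X b' k + 1] (mod int q ^ k)"
        by (intro cong_add) auto
      then show ?thesis
        unfolding ab by (intro padic_coord_eqI[OF chi_closed chi_closed numen_cong(2) numen_cong(2)])
    qed
  qed
qed

section \<open>Existence of the limit and interpolation of the numen\<close>

lemma numen_residue_stable:
  assumes z: "z \<in> carrier (padic_int 2)"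
    and "k \<le> (\<Sum>i<m. of_bool (bit (padic_residue z m) i))" and "m \<le> n"
  shows "X (padic_residue z n) k = X (padic_residue z m) k"
  using take_bit_padic_residue[OF z] assms
  by (intro numen_coord_eq[symmetric, of m]) auto

lemma numen_residue_eventually_const:
  assumes z: "z \<in> carrier (padic_int 2)"
  shows "\<exists>m. \<forall>n\<ge>m. X (padic_residue z n) k = X (padic_residue z m) k"
proof (cases "z \<in> padic_naturals 2")
  case True
  then obtain a where a: "z = padic_of_int 2 (int a)" by (auto simp: padic_naturals_def)
  \<comment> \<open>For a natural number all digits are seen once \<open>2 ^ n\<close> exceeds it,
    and \<open>a <= n < 2 ^ n\<close>.\<close>
  have "padic_residue z n = a" if "n \<ge> a" for n
  proof -
    have "a < 2 ^ n" using that by (meson le_less_trans less_exp)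
    then show ?thesis unfolding a by (rule padic_residue_of_int)
  qed
  then show ?thesis by (intro exI[of _ a]) simp
next
  case False
  then show ?thesis using padic_non_natural_ones[OF z] numen_residue_stable[OF z] by metis
qed

text \<open>The limit is assembled from the eventual values of the single coordinates, the index
  \<open>m k\<close> being the point where coordinate \<open>k\<close> has settled.\<close>

lemma numen_limit_exists:
  assumes z: "z \<in> carrier (padic_int 2)"
  shows "\<exists>x. limitin (padic_topology q) (\<lambda>n. X (padic_residue z n)) x sequentially"
proof -
  obtain m where m: "\<And>k n. n \<ge> m k \<Longrightarrow> X (padic_residue z n) k = X (padic_residue z (m k)) k"
    using numen_residue_eventually_const[OF z] by metis
  define x where "x = (\<lambda>k. X (padic_residue z (m k)) k)"
  have "x \<in> carrier (padic_int q)"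
    unfolding padic_carrier_iff
  proof
    fix k
    \<comment> \<open>At this index the coordinates \<open>k\<close> and \<open>Suc k\<close> have
      both settled, so their compatibility is inherited from a single q-adic integer.\<close>
    let ?n = "max (m k) (m (Suc k))"
    have "x k = X (padic_residue z ?n) k" "x (Suc k) = X (padic_residue z ?n) (Suc k)"
      using m[of k ?n] m[of "Suc k" ?n] by (simp_all add: x_def)
    then show "0 \<le> x k \<and> x k < int q ^ k \<and> x (Suc k) mod int q ^ k = x k"
      using chi_closed unfolding padic_carrier_iff by simp
  qed
  moreover have "\<forall>\<^sub>F n in sequentially. X (padic_residue z n) k = x k" for k
    unfolding eventually_sequentially x_def using m by blast
  ultimately show ?thesis using limitin_padic_iff[OF q(2) chi_closed] by blast
qed

lemma limitin_padic_unique: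
  assumes "limitin (padic_topology q) f x sequentially" "limitin (padic_topology q) f y sequentially"
  shows "x = y"
  using assms Metric_space.limitin_metric_unique[OF Metric_space_padic[OF q(2)]]
  unfolding padic_topology_def by (metis trivial_limit_sequentially)

lemma limitin_numen_limit:
  assumes z: "z \<in> carrier (padic_int 2)"
  shows "limitin (padic_topology q) (\<lambda>n. X (padic_residue z n)) (numen_limit q z) sequentially"
proof -
  have "\<exists>!x. limitin (padic_topology q) (\<lambda>n. X (padic_residue z n)) x sequentially"
    using numen_limit_exists[OF z] limitin_padic_unique by blast
  from theI'[OF this] show ?thesis unfolding numen_limit_def .
qed

lemma numen_limit_closed:
  "z \<in> carrier (padic_int 2) \<Longrightarrow> numen_limit q z \<in> carrier (padic_int q)"
  using limitin_numen_limit limitin_padic_iff[OF q(2) chi_closed] by blast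

lemma eventually_numen_limit:
  assumes "z \<in> carrier (padic_int 2)"
  shows "\<forall>\<^sub>F n in sequentially. X (padic_residue z n) k = numen_limit q z k"
  using limitin_numen_limit[OF assms] limitin_padic_iff[OF q(2) chi_closed] by blast

text \<open>The residues of a natural number are eventually the number itself, so the limit takes
  the original value. This is the interpolation property.\<close>

lemma numen_limit_of_nat: "numen_limit q (padic_of_int 2 (int m)) = X m"
proof -
  have "\<forall>\<^sub>F n in sequentially. X (padic_residue (padic_of_int 2 (int m)) n) k = X m k" for k
    using eventually_ge_at_top[of m]
  proof eventually_elim
    case (elim n)
    then have "m < 2 ^ n" by (meson le_less_trans less_exp)
    then show ?case by (simp add: padic_residue_of_int)
  qed
  then have "limitin (padic_topology q) (\<lambda>n. X (padic_residue (padic_of_int 2 (int m)) n)) (X m)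
      sequentially"
    using limitin_padic_iff[OF q(2) chi_closed] chi_closed by blast
  then show ?thesis
    by (rule limitin_padic_unique[OF limitin_numen_limit[OF padic_of_int_closed], rotated]) simp
qed

section \<open>Continuity away from the naturals\<close>

lemma numen_limit_continuous_at:
  assumes z: "z \<in> carrier (padic_int 2)" "z \<notin> padic_naturals 2"
  shows "topcontinuous_at (padic_topology 2) (padic_topology q) (numen_limit q) z"
proof (rule topcontinuous_at_padicI)
  fix k :: nat
  obtain m where m: "k \<le> (\<Sum>i<m. of_bool (bit (padic_residue z m) i))"
    using padic_non_natural_ones[OF z] by blast
  \<comment> \<open>The first \<open>m\<close> digits of \<open>z\<close> contain at least
    \<open>k\<close> ones. Every \<open>y\<close> sharing them has the same coordinate
    \<open>k\<close> of the numen along all its residues from \<open>m\<close> on, hence in the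
    limit. The case \<open>y = z\<close> is included, so both values get compared with the same
    constant.\<close>
  have *: "numen_limit q y k = X (padic_residue z m) k"
    if y: "y \<in> carrier (padic_int 2)" and "y m = z m" for y
  proof -
    have r: "padic_residue y m = padic_residue z m" using that by (simp add: padic_residue_def)
    have "\<forall>\<^sub>F n in sequentially. numen_limit q y k = X (padic_residue z m) k"
      using eventually_numen_limit[OF y, of k] eventually_ge_at_top[of m]
      by eventually_elim (metis numen_residue_stable[OF y] m r)
    then show ?thesis by simp
  qed
  then show "\<exists>n. \<forall>y\<in>carrier (padic_int 2). y n = z n \<longrightarrow> numen_limit q y k = numen_limit q z k"
    using z(1) by (intro exI[of _ m]) simp
qed (use q z numen_limit_closed in auto)

section \<open>Functional equations and rising-continuity of the limit\<close>

lemma numen_equations_iff: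
  assumes f: "f \<in> carrier (padic_int 2) \<rightarrow> carrier (padic_int q)"
  shows "numen_equations q f \<longleftrightarrow>
    (\<forall>z \<in> carrier (padic_int 2). \<forall>k.
      [2 * f (padic_of_int 2 2 \<otimes>\<^bsub>padic_int 2\<^esub> z) k = f z k] (mod int q ^ k) \<and>
      [2 * f (padic_of_int 2 2 \<otimes>\<^bsub>padic_int 2\<^esub> z \<oplus>\<^bsub>padic_int 2\<^esub> \<one>\<^bsub>padic_int 2\<^esub>) k
        = int q * f z k + 1] (mod int q ^ k))"
proof -
  note closed = padic_add_closed padic_mult_closed padic_one_closed padic_of_int_closed funcset_mem[OF f]
  have "[x = (padic_of_int q (int q) \<otimes>\<^bsub>padic_int q\<^esub> f z \<oplus>\<^bsub>padic_int q\<^esub> \<one>\<^bsub>padic_int q\<^esub>) k] (mod int q ^ k)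
      \<longleftrightarrow> [x = int q * f z k + 1] (mod int q ^ k)" for x z k
    by (simp add: padic_add_eq padic_mult_eq padic_one_eq padic_of_int_def cong_def mod_simps)
  then show ?thesis
    unfolding numen_equations_def
    using q_simps(1,2)
    by (auto simp: padic_divide_of_int_iff closed simp del: of_nat_numeral)
qed

text \<open>The congruences of \<open>numen_cong\<close> hold along the residues of
  \<open>z\<close>, and each coordinate is eventually equal to that of the limit. The resulting
  congruence does not involve \<open>n\<close>, so it holds outright.\<close>

lemma numen_equations_numen_limit: "numen_equations q (numen_limit q)"
proof -
  have "[2 * numen_limit q (padic_of_int 2 2 \<otimes>\<^bsub>padic_int 2\<^esub> z) k = numen_limit q z k] (mod int q ^ k)"
    "[2 * numen_limit q (padic_of_int 2 2 \<otimes>\<^bsub>padic_int 2\<^esub> z \<oplus>\<^bsub>padic_int 2\<^esub> \<one>\<^bsub>padic_int 2\<^esub>) k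
        = int q * numen_limit q z k + 1] (mod int q ^ k)"
    if z: "z \<in> carrier (padic_int 2)" for z k
  proof -
    let ?e = "padic_of_int 2 2 \<otimes>\<^bsub>padic_int 2\<^esub> z"
    let ?o = "?e \<oplus>\<^bsub>padic_int 2\<^esub> \<one>\<^bsub>padic_int 2\<^esub>"
    have e: "?e \<in> carrier (padic_int 2)" and o: "?o \<in> carrier (padic_int 2)"
      using z by (simp_all add: padic_add_closed padic_mult_closed padic_one_closed padic_of_int_closed)
    \<comment> \<open>The shift to \<open>Suc n\<close> matches \<open>padic_residue_double\<close>,
      which pairs residue \<open>Suc n\<close> of the doubled argument with residue \<open>n\<close>
      of \<open>z\<close>.\<close>
    have ev: "\<forall>\<^sub>F n in sequentially. X (padic_residue y (Suc n)) k = numen_limit q y k"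
      if "y \<in> carrier (padic_int 2)" for y
      using eventually_numen_limit[OF that, of k] by (subst eventually_sequentially_Suc)
    have "\<forall>\<^sub>F n in sequentially. [2 * numen_limit q ?e k = numen_limit q z k] (mod int q ^ k)"
      using ev[OF e] eventually_numen_limit[OF z, of k]
      by eventually_elim (metis padic_residue_double(1)[OF z] numen_cong(1))
    then show "[2 * numen_limit q ?e k = numen_limit q z k] (mod int q ^ k)" by simp
    have "\<forall>\<^sub>F n in sequentially. [2 * numen_limit q ?o k = int q * numen_limit q z k + 1] (mod int q ^ k)"
      using ev[OF o] eventually_numen_limit[OF z, of k]
      by eventually_elim (metis padic_residue_double(2)[OF z] numen_cong(2))
    then show "[2 * numen_limit q ?o k = int q * numen_limit q z k + 1] (mod int q ^ k)" by simp
  qed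
  then show ?thesis using numen_limit_closed by (subst numen_equations_iff) auto
qed

text \<open>Once the values at naturals are identified with the numen, this is the convergence that
  defines \<open>numen_limit\<close>.\<close>

lemma rising_continuous_numen_limit: "rising_continuous q (numen_limit q)"
  using limitin_numen_limit by (simp add: rising_continuous_def numen_limit_of_nat)

section \<open>Uniqueness: the equations fix the values on the naturals, rising-continuity the
  rest\<close>

lemma numen_equations_of_nat:
  assumes f: "f \<in> carrier (padic_int 2) \<rightarrow> carrier (padic_int q)" and eqs: "numen_equations q f"
  shows "f (padic_of_int 2 (int n)) = X n"
proof (induction n rule: less_induct)
  case (less n)
  have closed: "padic_of_int 2 a \<in> carrier (padic_int 2)" for a by (simp add: padic_of_int_closed)
  then have fc: "f (padic_of_int 2 a) \<in> carrier (padic_int q)" for a using f by blast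
  have even_arg: "padic_of_int 2 2 \<otimes>\<^bsub>padic_int 2\<^esub> padic_of_int 2 a = padic_of_int 2 (2 * a)" for a
    by (simp add: fun_eq_iff padic_mult_eq padic_of_int_def mod_simps)
  have odd_arg: "padic_of_int 2 (2 * a) \<oplus>\<^bsub>padic_int 2\<^esub> \<one>\<^bsub>padic_int 2\<^esub> = padic_of_int 2 (2 * a + 1)" for a
    by (simp add: fun_eq_iff padic_add_eq padic_one_eq padic_of_int_def mod_simps)
  have E: "[2 * f (padic_of_int 2 (2 * a)) k = f (padic_of_int 2 a) k] (mod int q ^ k)"
    and O: "[2 * f (padic_of_int 2 (2 * a + 1)) k = int q * f (padic_of_int 2 a) k + 1] (mod int q ^ k)"
    for a k
    using eqs[unfolded numen_equations_iff[OF f], rule_format, OF closed, of a k]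
    unfolding even_arg odd_arg by blast+
  show ?case
  proof
    fix k
    define m where "m = n div 2"
    \<comment> \<open>Strong induction along \<open>n div 2\<close>. Halving strictly decreases
      \<open>n\<close> except at 0, which therefore needs its own argument.\<close>
    consider "n = 0" | "n \<noteq> 0" "n = 2 * m" | "n = 2 * m + 1" unfolding m_def by linarith
    then show "f (padic_of_int 2 (int n)) k = X n k"
    proof cases
      case 1
      \<comment> \<open>Since doubling fixes 0, the even equation there relates the value to itself:
        \<open>2 * x\<close> is congruent to \<open>x\<close>, which forces the coordinate to
        vanish, for \<open>f\<close> and for the numen alike.\<close>
      have *: "x k = 0" if "x \<in> carrier (padic_int q)" "[2 * x k = x k] (mod int q ^ k)" for x
        using that padic_coord_mod[of x q k] by (simp add: cong_iff_dvd_diff)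
      show ?thesis
        using *[OF fc, of 0] *[OF chi_closed, of 0] E[of 0 k] numen_cong(1)[of 0 k] 1 by simp
    next
      case 2
      then have "f (padic_of_int 2 (int m)) = X m" using less by simp
      then show ?thesis
        using E[of "int m" k] numen_cong(1)[of m k] 2
        by (intro padic_coord_eqI[OF fc chi_closed]) auto
    next
      case 3
      then have "f (padic_of_int 2 (int m)) = X m" using less by simp
      then show ?thesis
        using O[of "int m" k] numen_cong(2)[of m k] 3
        by (intro padic_coord_eqI[OF fc chi_closed]) (auto simp: add.commute)
    qed
  qed
qed

text \<open>By rising-continuity \<open>f z\<close> is a limit of values at naturals, which are
  those of the numen; limits in a metric space are unique.\<close>

lemma numen_limit_unique:
  assumes f: "f \<in> carrier (padic_int 2) \<rightarrow> carrier (padic_int q)"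
    and eqs: "numen_equations q f" "rising_continuous q f" and z: "z \<in> carrier (padic_int 2)"
  shows "f z = numen_limit q z"
proof -
  have "limitin (padic_topology q) (\<lambda>n. X (padic_residue z n)) (f z) sequentially"
    using eqs(2) z numen_equations_of_nat[OF f eqs(1)] by (simp add: rising_continuous_def)
  then show ?thesis using limitin_padic_unique limitin_numen_limit[OF z] by blast
qed

end

theorem lemma4:
  fixes q :: nat
  assumes "prime q" and "odd q"
  shows
    "(\<forall>z \<in> carrier (padic_int 2). \<exists>x \<in> carrier (padic_int q).
        limitin (padic_topology q)
          (\<lambda>n. padic_of_rat q (numen q (padic_residue z n))) x sequentially) \<and>
     (\<forall>z \<in> carrier (padic_int 2).
        limitin (padic_topology q)
          (\<lambda>n. padic_of_rat q (numen q (padic_residue z n))) (numen_limit q z) sequentially) \<and>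
     numen_limit q \<in> carrier (padic_int 2) \<rightarrow> carrier (padic_int q) \<and>
     (\<forall>n. numen_limit q (padic_of_int 2 (int n)) = padic_of_rat q (numen q n)) \<and>
     (\<forall>z \<in> carrier (padic_int 2) - padic_naturals 2.
        topcontinuous_at (padic_topology 2) (padic_topology q) (numen_limit q) z) \<and>
     continuous_map
       (subtopology (padic_topology 2) (carrier (padic_int 2) - padic_naturals 2))
       (padic_topology q) (numen_limit q) \<and>
     numen_equations q (numen_limit q) \<and>
     rising_continuous q (numen_limit q) \<and>
     (\<forall>f \<in> carrier (padic_int 2) \<rightarrow> carrier (padic_int q).
        numen_equations q f \<and> rising_continuous q f \<longrightarrow>
        (\<forall>z \<in> carrier (padic_int 2). f z = numen_limit q z))"
proof -
  have q: "odd q" "q > 1" using assms prime_gt_1_nat by auto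
  have cont: "topcontinuous_at (padic_topology 2) (padic_topology q) (numen_limit q) z"
    if "z \<in> carrier (padic_int 2) - padic_naturals 2" for z
    using numen_limit_continuous_at[OF q] that by blast
  \<comment> \<open>Continuity at each point is meant in all of the 2-adic integers, which is
    stronger than continuity of the restriction and implies it.\<close>
  then have "continuous_map
       (subtopology (padic_topology 2) (carrier (padic_int 2) - padic_naturals 2))
       (padic_topology q) (numen_limit q)"
    unfolding continuous_map_eq_topcontinuous_at by (auto intro!: topcontinuous_at_subtopology)
  then show ?thesis
    using cont limitin_numen_limit[OF q] numen_limit_closed[OF q] numen_limit_of_nat[OF q]
      numen_equations_numen_limit[OF q] rising_continuous_numen_limit[OF q] numen_limit_unique[OF q]
    by (intro conjI) blast+
qed

end
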